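(* Let $\mathbf{d}=(d_1,\ldots,d_s)$. For every integer $m\ge 0$, $$ \begin{array}{ll} (i) & \dim (\mathcal{I}_{\mathbf{d}})_m=\omega_m(\mathbf{d};0)-\omega_m(\mathbf{d};2),\\ (ii) & \dim (\mathcal{S}_{\mathbf{d}})_m=\omega_m(\mathbf{d};0)+\omega_m(\mathbf{d};1). \end{array} $$
   Context: Let $\mathbb{K}$ be a field of characteristic $0$ and $\mathbf{d}=(d_1,\ldots,d_s)$ a tuple of nonnegative integers ($s\ge 1$). Let $\mathbb{K}[X_{\mathbf{d}}]$ be the polynomial algebra in the variables $x_i^{(k)}$, $1\le k\le s$, $0\le i\le d_k$. Define $\mathbb{K}$-linear derivations of $\mathbb{K}[X_{\mathbf{d}}]$ by $$\mathcal{D}_{\mathbf{d}}(x_i^{(k)})=i\,x_{i-1}^{(k)},\qquad \mathcal{D}^*_{\mathbf{d}}(x_i^{(k)})=(d_k-i)\,x_{i+1}^{(k)}$$ (with $\mathcal{D}_{\mathbf{d}}(x_0^{(k)})=0$ and $\mathcal{D}^*_{\mathbf{d}}(x_{d_k}^{(k)})=0$). The algebra of joint invariants is $\mathcal{I}_{\mathbf{d}}=\{v\in\mathbb{K}[X_{\mathbf{d}}] : \mathcal{D}_{\mathbf{d}}(v)=\mathcal{D}^*_{\mathbf{d}}(v)=0\}$ and the algebra of joint semi-invariants is $\mathcal{S}_{\mathbf{d}}=\ker\mathcal{D}_{\mathbf{d}}=\{v\in\mathbb{K}[X_{\mathbf{d}}] : \mathcal{D}_{\mathbf{d}}(v)=0\}$.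 Both are graded by total degree, and $(\cdot)_m$ denotes the homogeneous component of degree $m$; dimensions are over $\mathbb{K}$. For an integer $i$, $\omega_m(\mathbf{d};i)$ is the number of solutions in nonnegative integers $\alpha_j^{(k)}$ ($1\le k\le s$, $0\le j\le d_k$) of the system $$\sum_{k=1}^{s}\sum_{j=0}^{d_k}(d_k-2j)\,\alpha_j^{(k)}=i,\qquad \sum_{k=1}^{s}\sum_{j=0}^{d_k}\alpha_j^{(k)}=m.$$ *)

theory Defs
  imports Complex_Main "HOL-Library.Poly_Mapping" "HOL-Library.FuncSet"
begin

(* Polynomials in the variables x_i^(k), encoded as finitely supported maps from
   monomials to coefficients; a monomial maps the index pair (k, i) to the exponent
   of x_i^(k).  A tuple d = (d_1, ..., d_s) is a list, so the superscript k is counted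
   from 0 and d_(k+1) is d ! k. *)

type_synonym monom = "(nat \<times> nat) \<Rightarrow>\<^sub>0 nat"
type_synonym 'a mpoly = "monom \<Rightarrow>\<^sub>0 'a"

definition var :: "nat \<times> nat \<Rightarrow> 'a::comm_ring_1 mpoly"
  where "var v = Poly_Mapping.single (Poly_Mapping.single v 1) 1"

definition mscale :: "'a::comm_ring_1 \<Rightarrow> 'a mpoly \<Rightarrow> 'a mpoly"
  where "mscale c p = Poly_Mapping.single 0 c * p"

interpretation mpoly: vector_space "mscale :: 'a::field \<Rightarrow> 'a mpoly \<Rightarrow> 'a mpoly"
proof
  fix a b :: 'a and p q :: "'a mpoly"
  show "mscale a (p + q) = mscale a p + mscale a q"
    by (simp add: mscale_def distrib_left)
  show "mscale (a + b) p = mscale a p + mscale b p"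
    by (simp add: mscale_def single_add distrib_right)
  show "mscale a (mscale b p) = mscale (a * b) p"
    by (simp add: mscale_def mult_single mult.assoc[symmetric])
  show "mscale 1 p = p"
    by (simp add: mscale_def)
qed

definition index_set :: "nat list \<Rightarrow> (nat \<times> nat) set"
  where "index_set d = (SIGMA k:{..<length d}. {..d ! k})"

definition poly_alg :: "nat list \<Rightarrow> 'a::comm_ring_1 mpoly set"
  where "poly_alg d = {p. \<forall>\<mu>\<in>Poly_Mapping.keys p. Poly_Mapping.keys \<mu> \<subseteq> index_set d}"

definition monom_degree :: "monom \<Rightarrow> nat"
  where "monom_degree \<mu> = (\<Sum>v\<in>Poly_Mapping.keys \<mu>. Poly_Mapping.lookup \<mu> v)"

definition hom_component :: "'a::comm_ring_1 mpoly set \<Rightarrow> nat \<Rightarrow> 'a mpoly set"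
  where "hom_component A m = {p\<in>A. \<forall>\<mu>\<in>Poly_Mapping.keys p. monom_degree \<mu> = m}"

(* The derivation sending each variable v to f v, that is, the sum over all v of
   f v times the partial derivative with respect to v.  The lemmas below confirm that it is
   linear, satisfies the Leibniz rule and has the prescribed values on the variables;
   these properties determine it. *)

definition deriv_monom :: "(nat \<times> nat \<Rightarrow> 'a::comm_ring_1 mpoly) \<Rightarrow> monom \<Rightarrow> 'a \<Rightarrow> 'a mpoly"
  where "deriv_monom f \<mu> c =
    (\<Sum>v\<in>Poly_Mapping.keys \<mu>.
       Poly_Mapping.single (\<mu> - Poly_Mapping.single v 1) (c * of_nat (Poly_Mapping.lookup \<mu> v)) * f v)"

definition derivation :: "(nat \<times> nat \<Rightarrow> 'a::comm_ring_1 mpoly) \<Rightarrow> 'a mpoly \<Rightarrow> 'a mpoly"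
  where "derivation f p =
    (\<Sum>\<mu>\<in>Poly_Mapping.keys p. deriv_monom f \<mu> (Poly_Mapping.lookup p \<mu>))"

lemma deriv_monom_superset:
  assumes "finite V" "Poly_Mapping.keys \<mu> \<subseteq> V"
  shows "deriv_monom f \<mu> c = (\<Sum>v\<in>V.
       Poly_Mapping.single (\<mu> - Poly_Mapping.single v 1) (c * of_nat (Poly_Mapping.lookup \<mu> v)) * f v)"
  unfolding deriv_monom_def
  by (rule sum.mono_neutral_left) (use assms in \<open>auto simp: in_keys_iff\<close>)

lemma derivation_add: "derivation f (p + q) = derivation f p + derivation f q"
  unfolding derivation_def
  by (rule setsum_keys_plus_distrib)
    (simp_all add: deriv_monom_def distrib_right single_add sum.distrib)

lemma derivation_single: "derivation f (Poly_Mapping.single \<mu> c) = deriv_monom f \<mu> c"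
  by (cases "c = 0") (simp_all add: derivation_def deriv_monom_def)

lemma deriv_monom_mult:
  "deriv_monom f (\<mu> + \<nu>) (a * b) =
     deriv_monom f \<mu> a * Poly_Mapping.single \<nu> b + Poly_Mapping.single \<mu> a * deriv_monom f \<nu> b"
proof -
  have shift: "Poly_Mapping.single ((\<mu> + \<nu>) - Poly_Mapping.single v 1) (a * b * of_nat (Poly_Mapping.lookup \<mu> v))
      = Poly_Mapping.single (\<mu> - Poly_Mapping.single v 1) (a * of_nat (Poly_Mapping.lookup \<mu> v))
        * Poly_Mapping.single \<nu> b" for v and \<mu> \<nu> :: monom and a b :: 'a
  proof (cases "Poly_Mapping.lookup \<mu> v = 0")
    case False
    have "(\<mu> + \<nu>) - Poly_Mapping.single v 1 = (\<mu> - Poly_Mapping.single v 1) + \<nu>"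
      by (rule poly_mapping_eqI) (use False in \<open>auto simp: lookup_add lookup_minus lookup_single when_def\<close>)
    then show ?thesis by (simp add: mult_single mult.assoc mult.commute[of b "of_nat _"])
  qed simp
  let ?V = "Poly_Mapping.keys \<mu> \<union> Poly_Mapping.keys \<nu>"
  have V: "finite ?V" "Poly_Mapping.keys (\<mu> + \<nu>) \<subseteq> ?V" "Poly_Mapping.keys \<mu> \<subseteq> ?V"
    "Poly_Mapping.keys \<nu> \<subseteq> ?V"
    using keys_add[of \<mu> \<nu>] by auto
  show ?thesis
    unfolding deriv_monom_superset[OF V(1,2)] deriv_monom_superset[OF V(1,3)]
      deriv_monom_superset[OF V(1,4)] sum_distrib_left sum_distrib_right sum.distrib[symmetric]
  proof (rule sum.cong[OF refl])
    fix v
    show "Poly_Mapping.single (\<mu> + \<nu> - Poly_Mapping.single v 1)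
            (a * b * of_nat (Poly_Mapping.lookup (\<mu> + \<nu>) v)) * f v =
          Poly_Mapping.single (\<mu> - Poly_Mapping.single v 1) (a * of_nat (Poly_Mapping.lookup \<mu> v)) * f v
            * Poly_Mapping.single \<nu> b
        + Poly_Mapping.single \<mu> a
            * (Poly_Mapping.single (\<nu> - Poly_Mapping.single v 1) (b * of_nat (Poly_Mapping.lookup \<nu> v)) * f v)"
    proof -
      have "Poly_Mapping.single (\<mu> + \<nu> - Poly_Mapping.single v 1)
              (a * b * of_nat (Poly_Mapping.lookup (\<mu> + \<nu>) v)) =
            Poly_Mapping.single (\<mu> + \<nu> - Poly_Mapping.single v 1) (a * b * of_nat (Poly_Mapping.lookup \<mu> v))
          + Poly_Mapping.single (\<mu> + \<nu> - Poly_Mapping.single v 1) (a * b * of_nat (Poly_Mapping.lookup \<nu> v))"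
        by (simp only: lookup_add of_nat_add distrib_left single_add)
      also note shift[of \<mu> \<nu> v a b]
      also note shift[of \<nu> \<mu> v b a, unfolded add.commute[of \<nu> \<mu>] mult.commute[of b a]]
      finally show ?thesis
        by (simp add: distrib_right mult.assoc mult.commute[of "f v"])
    qed
  qed
qed

lemma mpoly_induct:
  assumes "P 0" "\<And>\<mu> c p. P p \<Longrightarrow> P (Poly_Mapping.single \<mu> c + p)"
  shows "P (p :: 'a::comm_ring_1 mpoly)"
proof (induction p rule: update_induct)
  case const
  then show ?case using assms(1) by simp
next
  case (update q \<mu> c)
  have "Poly_Mapping.lookup (Poly_Mapping.update \<mu> c q) \<nu> =
      Poly_Mapping.lookup (Poly_Mapping.single \<mu> c + q) \<nu>" for \<nu>
    using update(1)
    by (cases "\<nu> = \<mu>") (simp_all add: lookup_update lookup_add lookup_single_not_eq in_keys_iff)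
  then have "Poly_Mapping.update \<mu> c q = Poly_Mapping.single \<mu> c + q"
    by (rule poly_mapping_eqI)
  then show ?case using assms(2) update(3) by metis
qed

lemma derivation_Leibniz: "derivation f (p * q) = derivation f p * q + p * derivation f q"
proof (induction p rule: mpoly_induct)
  case 1
  show ?case by (simp add: derivation_def)
next
  case (2 \<mu> a p)
  have "derivation f (Poly_Mapping.single \<mu> a * q) =
      derivation f (Poly_Mapping.single \<mu> a) * q + Poly_Mapping.single \<mu> a * derivation f q"
  proof (induction q rule: mpoly_induct)
    case 1
    show ?case by (simp add: derivation_def)
  next
    case (2 \<nu> b q)
    then show ?case
      by (simp add: distrib_left derivation_add mult_single derivation_single deriv_monom_mult)
  qed
  with 2 show ?case by (simp add: distrib_right distrib_left derivation_add)
qed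

lemma derivation_mscale: "derivation f (mscale c p) = mscale c (derivation f p)"
  by (simp add: mscale_def derivation_Leibniz derivation_single deriv_monom_def)

lemma derivation_var: "derivation f (var v) = f v"
  by (simp add: var_def derivation_single deriv_monom_def)

(* For i = 0 and for i = d ! k the scalar factor below vanishes, giving the two boundary
   values 0.  Variables outside X_d, which do not occur in poly_alg d, are sent to 0. *)

definition D_op :: "nat list \<Rightarrow> 'a::comm_ring_1 mpoly \<Rightarrow> 'a mpoly"
  where "D_op d = derivation (\<lambda>(k, i).
    if (k, i) \<in> index_set d then mscale (of_nat i) (var (k, i - 1)) else 0)"

definition D_star :: "nat list \<Rightarrow> 'a::comm_ring_1 mpoly \<Rightarrow> 'a mpoly"
  where "D_star d = derivation (\<lambda>(k, i).
    if (k, i) \<in> index_set d then mscale (of_nat (d ! k - i)) (var (k, i + 1)) else 0)"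

lemma D_op_var:
  assumes "k < length d" "i \<le> d ! k"
  shows "D_op d (var (k, i)) = mscale (of_nat i) (var (k, i - 1))"
  using assms by (simp add: D_op_def derivation_var index_set_def)

lemma D_star_var:
  assumes "k < length d" "i \<le> d ! k"
  shows "D_star d (var (k, i)) = mscale (of_nat (d ! k - i)) (var (k, i + 1))"
  using assms by (simp add: D_star_def derivation_var index_set_def)

definition joint_invariants :: "nat list \<Rightarrow> 'a::comm_ring_1 mpoly set"
  where "joint_invariants d = {v\<in>poly_alg d. D_op d v = 0 \<and> D_star d v = 0}"

definition joint_semi_invariants :: "nat list \<Rightarrow> 'a::comm_ring_1 mpoly set"
  where "joint_semi_invariants d = {v\<in>poly_alg d. D_op d v = 0}"

(* Solutions are extensional functions on the index set, so that each is counted once. *)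

definition omega :: "nat \<Rightarrow> nat list \<Rightarrow> int \<Rightarrow> nat"
  where "omega m d i = card {\<alpha> \<in> index_set d \<rightarrow>\<^sub>E (UNIV :: nat set).
    (\<Sum>k<length d. \<Sum>j\<le>d ! k. (int (d ! k) - 2 * int j) * int (\<alpha> (k, j))) = i \<and>
    (\<Sum>k<length d. \<Sum>j\<le>d ! k. \<alpha> (k, j)) = m}"

end

(* Together with their commutator, D_op and D_star form an sl2-triple acting on the forms of
   degree m; the commutator acts on a monomial as its weight, the sum of (d_k - 2j) alpha_j^(k),
   D_op raises the weight by 2, and the monomials of weight w are counted by omega m d w.
   Because the weights are bounded, D_op is injective on each negative weight space and maps
   the space of weight w onto that of weight w + 2 when w >= -1.  Hence invariants
   are the kernel of D_op in weight 0 and semi-invariants its kernel in weights >= 0, and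
   rank-nullity gives their dimensions: D_op maps weight 0 onto weight 2, and weights >= 0
   onto weights >= 2. *)

theory Submission
  imports Defs
begin

section \<open>Rank-nullity on a subspace\<close>

text \<open>A basis \<open>B0\<close> of the kernel is extended to a basis \<open>B\<close> of
  \<open>V\<close>; \<open>f\<close> maps the added vectors \<open>?C\<close> injectively onto a
  basis of the image of \<open>V\<close>. The finite set \<open>T\<close> makes \<open>B\<close>
  finite, so that the cardinalities add up.\<close>

lemma (in vector_space) dim_kernel_image:
  assumes lin: "Vector_Spaces.linear scale scale f" and V: "subspace V"
    and fin: "finite T" "V \<subseteq> span T"
  shows "dim V = dim {v\<in>V. f v = 0} + dim (f ` V)"
proof -
  interpret vector_space_pair scale scale by unfold_locales
  interpret f: Vector_Spaces.linear scale scale f by (fact lin)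
  let ?K = "{v\<in>V. f v = 0}"
  obtain B0 where B0: "B0 \<subseteq> ?K" "independent B0" "?K \<subseteq> span B0" "card B0 = dim ?K"
    by (rule basis_exists)
  from B0(1) have "B0 \<subseteq> V" by blast
  then obtain B where B: "B0 \<subseteq> B" "B \<subseteq> V" "independent B" "V \<subseteq> span B"
    using maximal_independent_subset_extend[OF _ B0(2)] by metis
  have finB: "finite B"
    using independent_span_bound[OF fin(1) B(3)] B(2) fin(2) by blast
  let ?C = "B - B0"
  have indC: "independent ?C" using B(3) independent_mono by blast
  have spanC: "span ?C \<subseteq> V"
    by (rule span_minimal) (use B V in auto)
  \<comment> \<open>An element of \<open>span ?C\<close> killed by \<open>f\<close> also lies in
    \<open>span B0\<close>. Its coordinates in \<open>B\<close> are then supported both in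
    \<open>?C\<close> and in \<open>B0\<close>, which are disjoint, so all of them vanish.\<close>
  have inj: "inj_on f (span ?C)"
  proof (subst linear_inj_on_iff_eq_0[OF lin subspace_span], intro ballI impI)
    fix x assume x: "x \<in> span ?C" "f x = 0"
    with spanC B0(3) have x0: "x \<in> span B0" by blast
    have r0: "representation B x = representation B0 x"
      by (rule representation_extend[OF B(3) x0 B(1)])
    have r1: "representation B x = representation ?C x"
      by (rule representation_extend[OF B(3) x(1)]) blast
    have z: "representation ?C x b = 0" for b
      using representation_ne_zero[of B0 x b] representation_ne_zero[of ?C x b] r0 r1 by auto
    show "x = 0"
      using sum_nonzero_representation_eq[OF indC x(1)] by (simp add: z)
  qed
  have ind: "independent (f ` ?C)"
    by (rule linear_independent_injective_image[OF lin indC inj])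
  have "f ` V \<subseteq> span (f ` ?C)"
  proof -
    have "f ` B \<subseteq> span (f ` ?C)"
    proof
      fix y assume "y \<in> f ` B"
      then obtain b where b: "b \<in> B" "y = f b" by blast
      show "y \<in> span (f ` ?C)"
      proof (cases "b \<in> B0")
        case True
        then show ?thesis using B0(1) b span_zero by auto
      next
        case False
        then show ?thesis using b by (auto intro: span_base)
      qed
    qed
    then have "span (f ` B) \<subseteq> span (f ` ?C)"
      by (rule span_minimal[OF _ subspace_span])
    moreover have "f ` V \<subseteq> span (f ` B)"
      using B(4) linear_span_image[OF lin, of B] by auto
    ultimately show ?thesis by blast
  qed
  moreover have "f ` ?C \<subseteq> f ` V" using B(2) by blast
  moreover have "card (f ` ?C) = card ?C"
    by (rule card_image) (rule inj_on_subset[OF inj span_superset])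
  ultimately have "dim (f ` V) = card ?C"
    using ind dim_unique by metis
  moreover have "dim V = card B"
    using B(2-4) basis_card_eq_dim by metis
  moreover have "card B = card B0 + card ?C"
    using finB B(1) by (metis card_Diff_subset card_mono finite_subset le_add_diff_inverse)
  ultimately show ?thesis using B0(4) by simp
qed

section \<open>sl2-modules with bounded weights\<close>

text \<open>\<open>E\<close> and \<open>F\<close> are the raising and lowering operators; the third
  element of sl2 appears only through its eigenvalue \<open>w\<close> on \<open>W w\<close>. The
  bound \<open>N\<close> takes the place of finite dimension: it makes \<open>E\<close> and
  \<open>F\<close> nilpotent on every \<open>W w\<close>.\<close>

locale sl2_weight_module = vector_space scale
  for scale :: "'a::field_char_0 \<Rightarrow> 'b::ab_group_add \<Rightarrow> 'b" (infixr \<open>*s\<close> 75) +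
  fixes E F :: "'b \<Rightarrow> 'b" and W :: "int \<Rightarrow> 'b set" and N :: nat
  assumes E_linear: "Vector_Spaces.linear scale scale E" and F_linear: "Vector_Spaces.linear scale scale F"
    and W_subspace: "subspace (W w)"
    and E_W: "v \<in> W w \<Longrightarrow> E v \<in> W (w + 2)"
    and F_W: "v \<in> W w \<Longrightarrow> F v \<in> W (w - 2)"
    and commutator: "v \<in> W w \<Longrightarrow> E (F v) = F (E v) + of_int w *s v"
    and W_bounded: "v \<in> W w \<Longrightarrow> int N < \<bar>w\<bar> \<Longrightarrow> v = 0"
begin

sublocale E: Vector_Spaces.linear scale scale E by (fact E_linear)
sublocale F: Vector_Spaces.linear scale scale F by (fact F_linear)

lemma E_funpow_W: "v \<in> W w \<Longrightarrow> (E ^^ n) v \<in> W (w + 2 * int n)"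
proof (induction n)
  case (Suc n)
  have *: "w + 2 * int (Suc n) = w + 2 * int n + 2" by simp
  show ?case using E_W[OF Suc.IH[OF Suc.prems]] unfolding * by simp
qed simp

lemma F_funpow_W: "v \<in> W w \<Longrightarrow> (F ^^ n) v \<in> W (w - 2 * int n)"
proof (induction n)
  case (Suc n)
  have *: "w - 2 * int (Suc n) = w - 2 * int n - 2" by simp
  show ?case using F_W[OF Suc.IH[OF Suc.prems]] unfolding * by simp
qed simp

text \<open>Moving \<open>F\<close> past the \<open>n + 1\<close> factors \<open>E\<close> one at a
  time produces the weights \<open>w + 2 j\<close> for \<open>j = 0, ..., n\<close>, and these sum
  to \<open>(n + 1) (w + n)\<close>.\<close>

lemma E_funpow_F:
  assumes "v \<in> W w"
  shows "(E ^^ Suc n) (F v) =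
    F ((E ^^ Suc n) v) + of_int ((int n + 1) * (w + int n)) *s (E ^^ n) v"
proof (induction n)
  case 0
  then show ?case using commutator[OF assms] by simp
next
  case (Suc n)
  have "(E ^^ Suc (Suc n)) (F v) = E ((E ^^ Suc n) (F v))" by simp
  also have "\<dots> = E (F ((E ^^ Suc n) v)) + of_int ((int n + 1) * (w + int n)) *s (E ^^ Suc n) v"
    unfolding Suc by (simp add: E.add E.scale)
  also have "E (F ((E ^^ Suc n) v)) =
      F (E ((E ^^ Suc n) v)) + of_int (w + 2 * int (Suc n)) *s (E ^^ Suc n) v"
    by (rule commutator[OF E_funpow_W[OF assms]])
  also have "F (E ((E ^^ Suc n) v)) + of_int (w + 2 * int (Suc n)) *s (E ^^ Suc n) v
      + of_int ((int n + 1) * (w + int n)) *s (E ^^ Suc n) v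
    = F ((E ^^ Suc (Suc n)) v)
      + of_int (w + 2 * int (Suc n) + (int n + 1) * (w + int n)) *s (E ^^ Suc n) v"
    by (simp only: of_int_add scale_left_distrib add.assoc funpow.simps o_apply)
  also have "w + 2 * int (Suc n) + (int n + 1) * (w + int n) = (int (Suc n) + 1) * (w + int (Suc n))"
    by (simp add: algebra_simps)
  finally show ?case .
qed

text \<open>The mirror image of \<open>E_funpow_F\<close>: moving \<open>E\<close> past the factors
  \<open>F\<close> produces the weights \<open>w - 2 j\<close> for \<open>j = 0, ..., n\<close>,
  with sum \<open>(n + 1) (w - n)\<close>, and the term in which \<open>E\<close> reaches
  \<open>v\<close> vanishes.\<close>

lemma E_F_funpow:
  assumes "v \<in> W w" "E v = 0"
  shows "E ((F ^^ Suc n) v) = of_int ((int n + 1) * (w - int n)) *s (F ^^ n) v"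
proof (induction n)
  case 0
  then show ?case using commutator[OF assms(1)] assms(2) by simp
next
  case (Suc n)
  have "E ((F ^^ Suc (Suc n)) v) = E (F ((F ^^ Suc n) v))" by simp
  also have "\<dots> = F (E ((F ^^ Suc n) v)) + of_int (w - 2 * int (Suc n)) *s (F ^^ Suc n) v"
    by (rule commutator[OF F_funpow_W[OF assms(1)]])
  also have "F (E ((F ^^ Suc n) v)) = of_int ((int n + 1) * (w - int n)) *s (F ^^ Suc n) v"
    unfolding Suc by (simp add: F.scale)
  also have "of_int ((int n + 1) * (w - int n)) *s (F ^^ Suc n) v
      + of_int (w - 2 * int (Suc n)) *s (F ^^ Suc n) v
    = of_int ((int n + 1) * (w - int n) + (w - 2 * int (Suc n))) *s (F ^^ Suc n) v"
    by (simp only: of_int_add scale_left_distrib)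
  also have "(int n + 1) * (w - int n) + (w - 2 * int (Suc n)) = (int (Suc n) + 1) * (w - int (Suc n))"
    by (simp add: algebra_simps)
  finally show ?case .
qed

text \<open>The vector \<open>v - E (F v) / c\<close> with \<open>c = (n + 1) (w + n)\<close> is annihilated by one power of \<open>E\<close>
  less than \<open>v\<close>.\<close>
lemma E_funpow_kernel_in_image:
  assumes "v \<in> W w" "1 \<le> w" "(E ^^ n) v = 0"
  shows "v \<in> E ` W (w - 2)"
  using assms(1,3)
proof (induction n arbitrary: v)
  case 0
  then show ?case using E.zero subspace_0[OF W_subspace] by (metis funpow_0 image_eqI)
next
  case (Suc n)
  define c :: 'a where "c = of_int ((int n + 1) * (w + int n))"
  \<comment> \<open>Nonzero because \<open>w + n\<close> is positive and the characteristic is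
    0.\<close>
  have c: "c \<noteq> 0" unfolding c_def of_int_eq_0_iff using assms(2) by simp
  let ?u = "v - inverse c *s E (F v)"
  have FW: "F v \<in> W (w - 2)" using F_W Suc.prems by blast
  have "E (F v) \<in> W w" using E_W[OF FW] by simp
  then have u: "?u \<in> W w"
    using Suc.prems(1) subspace_diff subspace_scale W_subspace by blast
  have "(E ^^ Suc n) (F v) = c *s (E ^^ n) v"
    using E_funpow_F[OF Suc.prems(1), of n] Suc.prems(2) unfolding c_def by simp
  moreover have "(E ^^ n) (x - y) = (E ^^ n) x - (E ^^ n) y" for x y n
    by (induction n) (simp_all add: E.diff)
  moreover have "(E ^^ n) (a *s x) = a *s (E ^^ n) x" for a x n
    by (induction n) (simp_all add: E.scale)
  ultimately have "(E ^^ n) ?u = 0"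
    using c by (simp add: funpow_swap1)
  from Suc.IH[OF u this] obtain z where z: "z \<in> W (w - 2)" "?u = E z" by blast
  have "v = E (z + inverse c *s F v)"
    using z(2) by (simp add: E.add E.scale algebra_simps)
  moreover have "z + inverse c *s F v \<in> W (w - 2)"
    using z(1) FW subspace_add subspace_scale W_subspace by blast
  ultimately show ?case by blast
qed

text \<open>\<open>E ^^ N\<close> carries \<open>v\<close> to weight \<open>w + 2 N\<close>, which
  exceeds \<open>N\<close> because \<open>w\<close> is positive; so \<open>v\<close> is killed by a
  power of \<open>E\<close> and \<open>E_funpow_kernel_in_image\<close> applies.\<close>

lemma E_surj:
  assumes "v \<in> W w" "1 \<le> w"
  shows "v \<in> E ` W (w - 2)"
proof (rule E_funpow_kernel_in_image[OF assms])
  show "(E ^^ N) v = 0"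
    by (rule W_bounded[OF E_funpow_W[OF assms(1)]]) (use assms(2) in auto)
qed

text \<open>For negative \<open>w\<close> the factors \<open>(n + 1) (w - n)\<close> in
  \<open>E_F_funpow\<close> never vanish, so \<open>(F ^^ Suc n) v = 0\<close> forces
  \<open>(F ^^ n) v = 0\<close>. The weight bound gives \<open>(F ^^ N) v = 0\<close>, and descent
  from there reaches \<open>v = 0\<close>.\<close>

lemma E_inj:
  assumes v: "v \<in> W w" and "w < 0" and "E v = 0"
  shows "v = 0"
proof -
  have "(F ^^ n) v = 0 \<Longrightarrow> v = 0" for n
  proof (induction n)
    case (Suc n)
    have "of_int ((int n + 1) * (w - int n)) *s (F ^^ n) v = 0"
      using E_F_funpow[OF v assms(3), of n] Suc.prems E.zero by simp
    then have "(F ^^ n) v = 0"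
      using assms(2) by (simp only: scale_eq_0_iff of_int_eq_0_iff mult_eq_0_iff) linarith
    then show ?case by (rule Suc.IH)
  qed simp
  moreover have "(F ^^ N) v = 0"
    by (rule W_bounded[OF F_funpow_W[OF v]]) (use assms(2) in auto)
  ultimately show ?thesis by blast
qed

text \<open>\<open>F v\<close> has the negative weight -2, and the commutator vanishes in weight 0,
  so \<open>E (F v) = F (E v) = 0\<close> and \<open>E_inj\<close> applies.\<close>

lemma F_eq_0:
  assumes v: "v \<in> W 0" and "E v = 0"
  shows "F v = 0"
  by (rule E_inj[OF F_W[OF v]]) (use commutator[OF v] assms(2) F.zero in simp_all)

end

section \<open>Polynomials supported on a set of monomials\<close>

definition supported :: "monom set \<Rightarrow> 'a::comm_ring_1 mpoly set"
  where "supported B = {p. Poly_Mapping.keys p \<subseteq> B}"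

lemma mscale_single: "mscale a (Poly_Mapping.single \<mu> b) = Poly_Mapping.single \<mu> (a * b)"
  by (simp add: mscale_def mult_single)

lemma mpoly_eq_sum_single:
  "p = (\<Sum>\<mu>\<in>Poly_Mapping.keys p. Poly_Mapping.single \<mu> (Poly_Mapping.lookup p \<mu>))"
  for p :: "'a::comm_ring_1 mpoly"
proof (rule poly_mapping_eqI)
  fix \<nu>
  show "Poly_Mapping.lookup p \<nu> = Poly_Mapping.lookup
      (\<Sum>\<mu>\<in>Poly_Mapping.keys p. Poly_Mapping.single \<mu> (Poly_Mapping.lookup p \<mu>)) \<nu>"
    by (cases "\<nu> \<in> Poly_Mapping.keys p")
      (simp_all add: lookup_sum lookup_single when_def not_in_keys_iff_lookup_eq_zero)
qed

lemma lookup_mscale: "Poly_Mapping.lookup (mscale c p) \<mu> = c * Poly_Mapping.lookup p \<mu>"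
proof (induction p rule: mpoly_induct)
  case (2 \<nu> b p)
  have "mscale c (Poly_Mapping.single \<nu> b + p) = Poly_Mapping.single \<nu> (c * b) + mscale c p"
    by (simp add: mscale_def distrib_left mult_single)
  with 2 show ?case by (simp add: lookup_add lookup_single when_def distrib_left)
qed (simp add: mscale_def)

lemma subspace_supported: "mpoly.subspace (supported B :: 'a::field mpoly set)"
proof (rule mpoly.subspaceI)
  fix p q :: "'a mpoly" and c
  show "0 \<in> supported B" by (simp add: supported_def)
  show "p + q \<in> supported B" if "p \<in> supported B" "q \<in> supported B"
    using that keys_add[of p q] by (auto simp: supported_def)
  show "mscale c p \<in> supported B" if "p \<in> supported B"
    using that by (auto simp: supported_def in_keys_iff lookup_mscale)
qed

lemma supported_subset_span:
  "(supported B :: 'a::field mpoly set) \<subseteq> mpoly.span ((\<lambda>\<mu>. Poly_Mapping.single \<mu> 1) ` B)"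
proof
  fix p :: "'a mpoly" assume "p \<in> supported B"
  then have "Poly_Mapping.single \<mu> (Poly_Mapping.lookup p \<mu>)
      \<in> mpoly.span ((\<lambda>\<mu>. Poly_Mapping.single \<mu> 1) ` B)" if "\<mu> \<in> Poly_Mapping.keys p" for \<mu>
    using that mpoly.span_scale[OF mpoly.span_base, of "Poly_Mapping.single \<mu> 1" _ "Poly_Mapping.lookup p \<mu>"]
    by (auto simp: supported_def mscale_single)
  then show "p \<in> mpoly.span ((\<lambda>\<mu>. Poly_Mapping.single \<mu> 1) ` B)"
    by (subst mpoly_eq_sum_single[of p]) (rule mpoly.span_sum)
qed

text \<open>The monomials in \<open>B\<close> form a basis: every supported polynomial is the sum of
  its terms, and reading off one coefficient of a vanishing combination isolates one scalar.\<close>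

lemma dim_supported:
  assumes "finite B"
  shows "mpoly.dim (supported B :: 'a::field mpoly set) = card B"
proof (rule mpoly.dim_unique)
  let ?s = "\<lambda>\<mu>. Poly_Mapping.single \<mu> 1 :: 'a mpoly"
  have inj: "inj_on ?s B" by (auto simp: inj_on_def dest: arg_cong[where f = Poly_Mapping.keys])
  show "?s ` B \<subseteq> supported B" by (auto simp: supported_def)
  show "supported B \<subseteq> mpoly.span (?s ` B)" by (rule supported_subset_span)
  show "card (?s ` B) = card B" by (rule card_image[OF inj])
  show "mpoly.independent (?s ` B)"
  proof (rule mpoly.independent_if_scalars_zero)
    show "finite (?s ` B)" using assms by simp
  next
    fix f and x :: "'a mpoly"
    assume "(\<Sum>x\<in>?s ` B. mscale (f x) x) = 0" and "x \<in> ?s ` B"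
    then obtain \<mu> where \<mu>: "\<mu> \<in> B" "x = ?s \<mu>" and "(\<Sum>\<nu>\<in>B. mscale (f (?s \<nu>)) (?s \<nu>)) = 0"
      by (auto simp: sum.reindex[OF inj])
    then have "Poly_Mapping.lookup (\<Sum>\<nu>\<in>B. mscale (f (?s \<nu>)) (?s \<nu>)) \<mu> = 0" by simp
    then show "f x = 0"
      using \<mu> assms by (simp add: lookup_sum lookup_mscale lookup_single when_def if_distrib cong: if_cong)
  qed
qed


section \<open>Weights of monomials and the effect of the two derivations\<close>

text \<open>The eigenvalue of the commutator of \<open>D_op\<close> and \<open>D_star\<close> on the
  variable \<open>v\<close>.\<close>

definition wt :: "nat list \<Rightarrow> nat \<times> nat \<Rightarrow> int"
  where "wt d v = int (d ! fst v) - 2 * int (snd v)"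

definition weight :: "nat list \<Rightarrow> monom \<Rightarrow> int"
  where "weight d \<mu> = (\<Sum>v\<in>Poly_Mapping.keys \<mu>. wt d v * int (Poly_Mapping.lookup \<mu> v))"

definition mons :: "nat list \<Rightarrow> nat \<Rightarrow> monom set"
  where "mons d m = {\<mu>. Poly_Mapping.keys \<mu> \<subseteq> index_set d \<and> monom_degree \<mu> = m}"

text \<open>A set of weights, rather than a single one, lets the same lemmas serve a single weight
  space, its complement and all weights from 0 on.\<close>

definition weight_part :: "nat list \<Rightarrow> nat \<Rightarrow> int set \<Rightarrow> 'a::comm_ring_1 mpoly set"
  where "weight_part d m A = supported {\<mu>\<in>mons d m. weight d \<mu> \<in> A}"

lemma weight_add: "weight d (\<mu> + \<nu>) = weight d \<mu> + weight d \<nu>"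
  unfolding weight_def by (rule setsum_keys_plus_distrib) (simp_all add: distrib_left)

lemma weight_single: "weight d (Poly_Mapping.single v n) = wt d v * int n"
  by (simp add: weight_def)

lemma monom_degree_add: "monom_degree (\<mu> + \<nu>) = monom_degree \<mu> + monom_degree \<nu>"
  unfolding monom_degree_def by (rule setsum_keys_plus_distrib) simp_all

lemma monom_degree_single: "monom_degree (Poly_Mapping.single v n) = n"
  by (simp add: monom_degree_def)

text \<open>Exponents are subtracted with truncation at 0; the occurrence of \<open>v\<close> in
  \<open>\<mu>\<close> is what makes the subtraction reversible.\<close>

lemma minus_single_plus_single:
  fixes \<mu> :: monom
  assumes "v \<in> Poly_Mapping.keys \<mu>"
  shows "\<mu> - Poly_Mapping.single v 1 + Poly_Mapping.single v 1 = \<mu>"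
  by (rule poly_mapping_eqI)
    (use assms in \<open>auto simp: lookup_add lookup_minus lookup_single when_def in_keys_iff\<close>)

text \<open>Describes one term of a derivation that sends \<open>v\<close> to a multiple of
  \<open>var u\<close>: one factor \<open>v\<close> is traded for \<open>u\<close>.\<close>

lemma mons_move:
  assumes "\<mu> \<in> mons d m" "v \<in> Poly_Mapping.keys \<mu>" "u \<in> index_set d"
  shows "\<mu> - Poly_Mapping.single v 1 + Poly_Mapping.single u 1 \<in> mons d m"
proof -
  let ?\<nu> = "\<mu> - Poly_Mapping.single v 1"
  have "Poly_Mapping.keys ?\<nu> \<subseteq> Poly_Mapping.keys \<mu>"
    by (auto simp: in_keys_iff lookup_minus)
  then have "Poly_Mapping.keys (?\<nu> + Poly_Mapping.single u 1) \<subseteq> index_set d"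
    using keys_add[of ?\<nu> "Poly_Mapping.single u 1"] assms(1,3) by (auto simp: mons_def)
  moreover have "monom_degree (?\<nu> + Poly_Mapping.single u 1) = monom_degree \<mu>"
    using arg_cong[OF minus_single_plus_single[OF assms(2)], of monom_degree]
    by (simp add: monom_degree_add monom_degree_single)
  ultimately show ?thesis using assms(1) by (simp add: mons_def)
qed

lemma weight_move:
  assumes "v \<in> Poly_Mapping.keys \<mu>"
  shows "weight d (\<mu> - Poly_Mapping.single v 1 + Poly_Mapping.single u 1) = weight d \<mu> - wt d v + wt d u"
  using arg_cong[OF minus_single_plus_single[OF assms], of "weight d"]
  by (simp add: weight_add weight_single)

lemma keys_derivation:
  assumes "\<kappa> \<in> Poly_Mapping.keys (derivation f p)"
  obtains \<mu> v \<nu> where "\<mu> \<in> Poly_Mapping.keys p" "v \<in> Poly_Mapping.keys \<mu>"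
    "\<nu> \<in> Poly_Mapping.keys (f v)" "\<kappa> = \<mu> - Poly_Mapping.single v 1 + \<nu>"
proof -
  let ?s = "\<lambda>\<mu> v. Poly_Mapping.single (\<mu> - Poly_Mapping.single v 1)
    (Poly_Mapping.lookup p \<mu> * of_nat (Poly_Mapping.lookup \<mu> v))"
  have "\<kappa> \<in> (\<Union>\<mu>\<in>Poly_Mapping.keys p. Poly_Mapping.keys (deriv_monom f \<mu> (Poly_Mapping.lookup p \<mu>)))"
    using assms unfolding derivation_def by (rule subsetD[OF keys_sum])
  then obtain \<mu> where \<mu>: "\<mu> \<in> Poly_Mapping.keys p"
      "\<kappa> \<in> Poly_Mapping.keys (deriv_monom f \<mu> (Poly_Mapping.lookup p \<mu>))" ..
  have "\<kappa> \<in> (\<Union>v\<in>Poly_Mapping.keys \<mu>. Poly_Mapping.keys (?s \<mu> v * f v))"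
    using \<mu>(2) unfolding deriv_monom_def by (rule subsetD[OF keys_sum])
  then obtain v where v: "v \<in> Poly_Mapping.keys \<mu>" "\<kappa> \<in> Poly_Mapping.keys (?s \<mu> v * f v)" ..
  have "\<kappa> \<in> {a + b | a b. a \<in> Poly_Mapping.keys (?s \<mu> v) \<and> b \<in> Poly_Mapping.keys (f v)}"
    using v(2) by (rule subsetD[OF keys_mult])
  then obtain \<nu> where "\<nu> \<in> Poly_Mapping.keys (f v)" "\<kappa> = \<mu> - Poly_Mapping.single v 1 + \<nu>"
    by (auto split: if_splits)
  with \<mu>(1) v(1) show thesis by (rule that)
qed

lemma keys_mscale_var: "Poly_Mapping.keys (mscale c (var v)) \<subseteq> {Poly_Mapping.single v 1}"
  by (simp add: var_def mscale_single)

text \<open>Every term trades a variable of index \<open>i\<close> for the one of index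
  \<open>i - 1\<close> with the same \<open>k\<close>, whose weight is larger by 2; hence a weight
  \<open>w\<close> in the result comes from the weight \<open>w - 2\<close> in
  \<open>p\<close>.\<close>

lemma D_op_weight_part:
  assumes "p \<in> weight_part d m A"
  shows "D_op d p \<in> weight_part d m {w. w - 2 \<in> A}"
  unfolding weight_part_def supported_def
proof (rule CollectI, rule subsetI)
  fix \<kappa> assume "\<kappa> \<in> Poly_Mapping.keys (D_op d p)"
  then obtain \<mu> v \<nu> where \<mu>: "\<mu> \<in> Poly_Mapping.keys p" and v: "v \<in> Poly_Mapping.keys \<mu>"
    and \<nu>: "\<nu> \<in> Poly_Mapping.keys (case v of (k, i) \<Rightarrow>
      if (k, i) \<in> index_set d then mscale (of_nat i) (var (k, i - 1)) else (0 :: 'a mpoly))"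
    and \<kappa>: "\<kappa> = \<mu> - Poly_Mapping.single v 1 + \<nu>"
    unfolding D_op_def by (rule keys_derivation)
  obtain k i where ki: "v = (k, i)" by fastforce
  \<comment> \<open>For \<open>i = 0\<close> the truncated \<open>i - 1\<close> would be 0 again and
    the weight would not rise; the scalar \<open>of_nat i\<close> removes this case.\<close>
  have *: "(k, i) \<in> index_set d" "i \<noteq> 0" "\<nu> = Poly_Mapping.single (k, i - 1) 1"
  proof -
    have \<nu>': "(k, i) \<in> index_set d"
        "\<nu> \<in> Poly_Mapping.keys (mscale (of_nat i) (var (k, i - 1)) :: 'a mpoly)"
      using \<nu> by (simp_all add: ki split: if_splits del: of_nat_diff)
    show "(k, i) \<in> index_set d" by (rule \<nu>'(1))
    show "\<nu> = Poly_Mapping.single (k, i - 1) 1"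
      using subsetD[OF keys_mscale_var \<nu>'(2)] by simp
    show "i \<noteq> 0"
    proof
      assume "i = 0"
      then show False using \<nu>'(2) by (simp only: mscale_def of_nat_0 single_zero mult_zero_left keys_zero empty_iff)
    qed
  qed
  have \<mu>': "\<mu> \<in> mons d m" "weight d \<mu> \<in> A" using \<mu> assms by (auto simp: weight_part_def supported_def)
  have "(k, i - 1) \<in> index_set d" using * by (auto simp: index_set_def)
  then show "\<kappa> \<in> {\<mu>\<in>mons d m. weight d \<mu> \<in> {w. w - 2 \<in> A}}"
    using \<mu>' mons_move[OF \<mu>'(1) v] weight_move[OF v, of d "(k, i - 1)"] *(2)
    by (simp add: \<kappa> *(3) ki wt_def of_nat_diff)
qed

lemma D_star_weight_part:
  assumes "p \<in> weight_part d m A"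
  shows "D_star d p \<in> weight_part d m {w. w + 2 \<in> A}"
  unfolding weight_part_def supported_def
proof (rule CollectI, rule subsetI)
  fix \<kappa> assume "\<kappa> \<in> Poly_Mapping.keys (D_star d p)"
  then obtain \<mu> v \<nu> where \<mu>: "\<mu> \<in> Poly_Mapping.keys p" and v: "v \<in> Poly_Mapping.keys \<mu>"
    and \<nu>: "\<nu> \<in> Poly_Mapping.keys (case v of (k, i) \<Rightarrow>
      if (k, i) \<in> index_set d then mscale (of_nat (d ! k - i)) (var (k, i + 1)) else (0 :: 'a mpoly))"
    and \<kappa>: "\<kappa> = \<mu> - Poly_Mapping.single v 1 + \<nu>"
    unfolding D_star_def by (rule keys_derivation)
  obtain k i where ki: "v = (k, i)" by fastforce
  \<comment> \<open>For \<open>i = d ! k\<close> the new variable would leave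
    \<open>index_set d\<close>; the vanishing scalar removes this case.\<close>
  have *: "(k, i) \<in> index_set d" "d ! k - i \<noteq> 0" "\<nu> = Poly_Mapping.single (k, i + 1) 1"
  proof -
    have \<nu>': "(k, i) \<in> index_set d"
        "\<nu> \<in> Poly_Mapping.keys (mscale (of_nat (d ! k - i)) (var (k, i + 1)) :: 'a mpoly)"
      using \<nu> by (simp_all add: ki split: if_splits del: of_nat_diff)
    show "(k, i) \<in> index_set d" by (rule \<nu>'(1))
    show "\<nu> = Poly_Mapping.single (k, i + 1) 1"
      using subsetD[OF keys_mscale_var \<nu>'(2)] by simp
    show "d ! k - i \<noteq> 0"
    proof
      assume "d ! k - i = 0"
      then show False using \<nu>'(2) by (simp only: mscale_def of_nat_0 single_zero mult_zero_left keys_zero empty_iff)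
    qed
  qed
  have \<mu>': "\<mu> \<in> mons d m" "weight d \<mu> \<in> A" using \<mu> assms by (auto simp: weight_part_def supported_def)
  have "(k, i + 1) \<in> index_set d" using * by (auto simp: index_set_def)
  then show "\<kappa> \<in> {\<mu>\<in>mons d m. weight d \<mu> \<in> {w. w + 2 \<in> A}}"
    using \<mu>' mons_move[OF \<mu>'(1) v] weight_move[OF v, of d "(k, i + 1)"]
    by (simp add: \<kappa> *(3) ki wt_def)
qed

section \<open>The commutator of the two derivations\<close>

lemma derivation_zero: "derivation f 0 = 0"
  by (simp add: derivation_def)

text \<open>The difference \<open>T\<close> of the two sides is itself a derivation, since the mixed
  terms of the commutator cancel. It vanishes on constants and on variables, hence
  everywhere.\<close>

lemma derivation_commutator:
  fixes f g :: "nat \<times> nat \<Rightarrow> 'a::comm_ring_1 mpoly"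
  shows "derivation f (derivation g p) - derivation g (derivation f p) =
    derivation (\<lambda>v. derivation f (g v) - derivation g (f v)) p"
proof -
  define T where "T p = derivation f (derivation g p) - derivation g (derivation f p)
    - derivation (\<lambda>v. derivation f (g v) - derivation g (f v)) p" for p
  have add: "T (p + q) = T p + T q" for p q
    by (simp add: T_def derivation_add)
  have Leibniz: "T (p * q) = T p * q + p * T q" for p q
    by (simp add: T_def derivation_add derivation_Leibniz algebra_simps)
  have zero: "T 0 = 0" by (simp add: T_def derivation_zero)
  have const: "T (Poly_Mapping.single 0 c) = 0" for c
    by (simp add: T_def derivation_single deriv_monom_def derivation_zero)
  have var: "T (var v) = 0" for v
    by (simp add: T_def derivation_var)
  \<comment> \<open>Pure powers come first because \<open>update_induct\<close> adds a fresh
    variable together with its whole exponent.\<close>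
  have var_power: "T (Poly_Mapping.single (Poly_Mapping.single v n) 1) = 0" for v n
  proof (induction n)
    case 0
    then show ?case using const[of 1] by simp
  next
    case (Suc n)
    have "Poly_Mapping.single (Poly_Mapping.single v (Suc n)) 1 =
        var v * Poly_Mapping.single (Poly_Mapping.single v n) (1 :: 'a)"
      by (simp add: var_def mult_single single_add[symmetric])
    then show ?case using Suc var by (simp add: Leibniz)
  qed
  have monom: "T (Poly_Mapping.single \<mu> 1) = 0" for \<mu>
  proof (induction \<mu> rule: update_induct)
    case const
    show ?case using \<open>T (Poly_Mapping.single 0 1) = 0\<close> by simp
  next
    case (update \<mu> v n)
    have "Poly_Mapping.lookup (Poly_Mapping.update v n \<mu>) u =
        Poly_Mapping.lookup (Poly_Mapping.single v n + \<mu>) u" for u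
      using update(1)
      by (cases "u = v") (simp_all add: lookup_update lookup_add lookup_single_not_eq in_keys_iff)
    then have "Poly_Mapping.update v n \<mu> = Poly_Mapping.single v n + \<mu>"
      by (rule poly_mapping_eqI)
    then have "Poly_Mapping.single (Poly_Mapping.update v n \<mu>) 1 =
        Poly_Mapping.single (Poly_Mapping.single v n) (1 :: 'a) * Poly_Mapping.single \<mu> 1"
      by (simp add: mult_single)
    then show ?case using update(3) var_power by (simp add: Leibniz)
  qed
  have "T p = 0"
  proof (induction p rule: mpoly_induct)
    case (2 \<mu> c p)
    have "Poly_Mapping.single \<mu> c = Poly_Mapping.single 0 c * Poly_Mapping.single \<mu> 1"
      by (simp add: mult_single)
    then have "T (Poly_Mapping.single \<mu> c) = 0"
      using const monom by (simp only: Leibniz mult_zero_left mult_zero_right add_0)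
    with 2 show ?case by (simp add: add)
  qed (rule zero)
  then show ?thesis by (simp add: T_def)
qed

text \<open>The commutator is the derivation \<open>?h\<close>, which multiplies each variable by
  its \<open>wt\<close>; by the Leibniz rule the weights of the factors of a monomial add up.
  Comparing single coefficients allows \<open>p\<close> to mix several weights.\<close>

lemma lookup_D_commutator:
  fixes p :: "'a::field_char_0 mpoly"
  assumes "p \<in> poly_alg d"
  shows "Poly_Mapping.lookup (D_op d (D_star d p) - D_star d (D_op d p)) \<mu> =
    of_int (weight d \<mu>) * Poly_Mapping.lookup p \<mu>"
proof -
  let ?f = "\<lambda>(k, i). if (k, i) \<in> index_set d then mscale (of_nat i) (var (k, i - 1)) else (0 :: 'a mpoly)"
  let ?g = "\<lambda>(k, i). if (k, i) \<in> index_set d then mscale (of_nat (d ! k - i)) (var (k, i + 1))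
    else (0 :: 'a mpoly)"
  let ?h = "\<lambda>v. derivation ?f (?g v) - derivation ?g (?f v)"
  have h: "?h v = mscale (of_int (wt d v)) (var v)" if "v \<in> index_set d" for v
  proof -
    obtain k i where v: "v = (k, i)" by fastforce
    have i: "k < length d" "i \<le> d ! k" using that by (auto simp: v index_set_def)
    have 1: "derivation ?f (?g v) = mscale (of_nat ((d ! k - i) * (i + 1))) (var v)"
    proof (cases "i = d ! k")
      case True
      then show ?thesis using that by (simp add: v derivation_zero)
    next
      case False
      then have "(k, i + 1) \<in> index_set d" using i by (auto simp: index_set_def)
      then show ?thesis using that
        by (simp add: v derivation_mscale derivation_var distrib_left del: of_nat_diff)
    qed
    have 2: "derivation ?g (?f v) = mscale (of_nat (i * (d ! k - (i - 1)))) (var v)"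
    proof (cases "i = 0")
      case True
      then show ?thesis using that by (simp add: v derivation_zero)
    next
      case False
      then have "(k, i - 1) \<in> index_set d" using i by (auto simp: index_set_def)
      then show ?thesis using that False
        by (simp add: v derivation_mscale derivation_var del: of_nat_diff)
    qed
    \<comment> \<open>With \<open>t\<close> the truncated subtractions disappear:
      \<open>t (i + 1) - i (t + 1) = t - i = d ! k - 2 i\<close>. In the case \<open>i = 0\<close>
      the second product is 0 whatever \<open>i - 1\<close> means.\<close>
    obtain t where "d ! k = i + t" using i le_iff_add by blast
    then have "int ((d ! k - i) * (i + 1)) - int (i * (d ! k - (i - 1))) = wt d v"
      by (cases i) (simp_all add: v wt_def algebra_simps)
    then have "of_nat ((d ! k - i) * (i + 1)) - of_nat (i * (d ! k - (i - 1))) = (of_int (wt d v) :: 'a)"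
      by (metis of_int_diff of_int_of_nat_eq)
    then show ?thesis unfolding 1 2 by (simp only: mpoly.scale_left_diff_distrib[symmetric])
  qed
  have dm: "deriv_monom ?h \<nu> c = Poly_Mapping.single \<nu> (of_int (weight d \<nu>) * c)"
    if "Poly_Mapping.keys \<nu> \<subseteq> index_set d" for \<nu> c
  proof -
    \<comment> \<open>A weighted Euler operator: a factor \<open>v\<close> is taken out and put
      back, so \<open>\<nu>\<close> itself survives with a scalar.\<close>
    have "deriv_monom ?h \<nu> c = (\<Sum>v\<in>Poly_Mapping.keys \<nu>.
        Poly_Mapping.single \<nu> (of_int (wt d v * int (Poly_Mapping.lookup \<nu> v)) * c))"
      unfolding deriv_monom_def
    proof (rule sum.cong[OF refl])
      fix v assume v: "v \<in> Poly_Mapping.keys \<nu>"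
      with that have "v \<in> index_set d" by blast
      then show "Poly_Mapping.single (\<nu> - Poly_Mapping.single v 1) (c * of_nat (Poly_Mapping.lookup \<nu> v)) * ?h v
          = Poly_Mapping.single \<nu> (of_int (wt d v * int (Poly_Mapping.lookup \<nu> v)) * c)"
        unfolding h[OF \<open>v \<in> index_set d\<close>]
        using minus_single_plus_single[OF v]
        by (simp add: var_def mscale_single mult_single add.commute mult.commute mult.left_commute)
    qed
    also have "\<dots> = Poly_Mapping.single \<nu> (of_int (weight d \<nu>) * c)"
      by (rule poly_mapping_eqI)
        (simp add: lookup_sum lookup_single when_def weight_def sum_distrib_right)
    finally show ?thesis .
  qed
  have "D_op d (D_star d p) - D_star d (D_op d p) = derivation ?h p"
    unfolding D_op_def D_star_def by (rule derivation_commutator)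
  also have "\<dots> = (\<Sum>\<nu>\<in>Poly_Mapping.keys p.
      Poly_Mapping.single \<nu> (of_int (weight d \<nu>) * Poly_Mapping.lookup p \<nu>))"
    unfolding derivation_def[of _ p]
    by (rule sum.cong[OF refl], rule dm) (use assms in \<open>auto simp: poly_alg_def\<close>)
  finally show ?thesis
    by (cases "\<mu> \<in> Poly_Mapping.keys p")
      (simp_all add: lookup_sum lookup_single when_def not_in_keys_iff_lookup_eq_zero)
qed

section \<open>Counting monomials of given degree and weight\<close>

lemma finite_index_set: "finite (index_set d)"
  by (simp add: index_set_def)

text \<open>Links the sums over occurring variables in \<open>weight\<close> and
  \<open>monom_degree\<close> with the double sums in \<open>omega\<close>; the additional variables
  have exponent 0 and contribute nothing.\<close>

lemma sum_keys_index_set: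
  fixes \<mu> :: monom
  assumes "Poly_Mapping.keys \<mu> \<subseteq> index_set d" and "\<And>v. g v 0 = 0"
  shows "(\<Sum>v\<in>Poly_Mapping.keys \<mu>. g v (Poly_Mapping.lookup \<mu> v)) =
    (\<Sum>k<length d. \<Sum>j\<le>d ! k. g (k, j) (Poly_Mapping.lookup \<mu> (k, j)))"
proof -
  have "(\<Sum>v\<in>Poly_Mapping.keys \<mu>. g v (Poly_Mapping.lookup \<mu> v)) =
      (\<Sum>v\<in>index_set d. g v (Poly_Mapping.lookup \<mu> v))"
    by (rule sum.mono_neutral_left) (use assms finite_index_set in \<open>auto simp: in_keys_iff\<close>)
  then show ?thesis by (simp add: index_set_def sum.Sigma split_def)
qed

text \<open>Two encodings of exponent vectors on \<open>S\<close> are matched: a monomial is 0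
  outside \<open>S\<close>, an extensional function is \<open>undefined\<close> there.\<close>

lemma bij_betw_monom_PiE:
  "bij_betw (\<lambda>\<mu>. restrict (Poly_Mapping.lookup \<mu>) S) {\<mu>. Poly_Mapping.keys \<mu> \<subseteq> S} (S \<rightarrow>\<^sub>E (UNIV :: nat set))"
  if "finite S" for S :: "(nat \<times> nat) set"
proof (rule bij_betwI[where g = "\<lambda>\<alpha>. Abs_poly_mapping (\<lambda>v. if v \<in> S then \<alpha> v else 0)"])
  have fin: "finite {v. (if v \<in> S then \<alpha> v else 0) \<noteq> 0}" for \<alpha> :: "nat \<times> nat \<Rightarrow> nat"
    by (rule finite_subset[OF _ that]) auto
  have lookup_Abs: "Poly_Mapping.lookup (Abs_poly_mapping (\<lambda>v. if v \<in> S then \<alpha> v else 0)) =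
      (\<lambda>v. if v \<in> S then \<alpha> v else 0)" for \<alpha> :: "nat \<times> nat \<Rightarrow> nat"
    using fin[of \<alpha>] by (simp add: Abs_poly_mapping_inverse)
  show "(\<lambda>\<alpha>. Abs_poly_mapping (\<lambda>v. if v \<in> S then \<alpha> v else 0))
      \<in> (S \<rightarrow>\<^sub>E (UNIV :: nat set)) \<rightarrow> {\<mu>. Poly_Mapping.keys \<mu> \<subseteq> S}"
    by (fastforce simp: in_keys_iff lookup_Abs split: if_splits)
  show "Abs_poly_mapping (\<lambda>v. if v \<in> S then restrict (Poly_Mapping.lookup \<mu>) S v else 0) = \<mu>"
    if "\<mu> \<in> {\<mu>. Poly_Mapping.keys \<mu> \<subseteq> S}" for \<mu> :: monom
    by (rule poly_mapping_eqI)
      (use that in \<open>auto simp: lookup_Abs in_keys_iff\<close>)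
  show "restrict (Poly_Mapping.lookup (Abs_poly_mapping (\<lambda>v. if v \<in> S then \<alpha> v else 0))) S = \<alpha>"
    if "\<alpha> \<in> S \<rightarrow>\<^sub>E UNIV" for \<alpha> :: "nat \<times> nat \<Rightarrow> nat"
    by (rule ext) (use that in \<open>auto simp: lookup_Abs PiE_def extensional_def\<close>)
qed auto

lemma card_mons_weight: "card {\<mu>\<in>mons d m. weight d \<mu> = w} = omega m d w"
proof -
  let ?r = "\<lambda>\<mu> :: monom. restrict (Poly_Mapping.lookup \<mu>) (index_set d)"
  let ?Q = "\<lambda>\<alpha>. (\<Sum>k<length d. \<Sum>j\<le>d ! k. (int (d ! k) - 2 * int j) * int (\<alpha> (k, j))) = w \<and>
    (\<Sum>k<length d. \<Sum>j\<le>d ! k. \<alpha> (k, j)) = m"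
  have "bij_betw ?r {\<mu>\<in>{\<mu>. Poly_Mapping.keys \<mu> \<subseteq> index_set d}. monom_degree \<mu> = m \<and> weight d \<mu> = w}
      {\<alpha>\<in>index_set d \<rightarrow>\<^sub>E (UNIV :: nat set). ?Q \<alpha>}"
  proof (rule bij_betw_Collect[OF bij_betw_monom_PiE[OF finite_index_set]])
    fix \<mu> :: monom assume "\<mu> \<in> {\<mu>. Poly_Mapping.keys \<mu> \<subseteq> index_set d}"
    then have \<mu>: "Poly_Mapping.keys \<mu> \<subseteq> index_set d" by simp
    have r: "?r \<mu> (k, j) = Poly_Mapping.lookup \<mu> (k, j)" if "k < length d" "j \<le> d ! k" for k j
      using that by (simp add: index_set_def)
    have "weight d \<mu> = (\<Sum>k<length d. \<Sum>j\<le>d ! k. (int (d ! k) - 2 * int j) * int (?r \<mu> (k, j)))"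
      using sum_keys_index_set[OF \<mu>, of "\<lambda>v n. wt d v * int n"] r by (simp add: weight_def wt_def)
    moreover have "monom_degree \<mu> = (\<Sum>k<length d. \<Sum>j\<le>d ! k. ?r \<mu> (k, j))"
      using sum_keys_index_set[OF \<mu>, of "\<lambda>v n. n"] r by (simp add: monom_degree_def)
    ultimately show "?Q (?r \<mu>) \<longleftrightarrow> monom_degree \<mu> = m \<and> weight d \<mu> = w" by auto
  qed
  then show ?thesis
    unfolding omega_def mons_def using bij_betw_same_card by fastforce
qed

text \<open>No exponent exceeds the degree, so the exponent vectors lie in a finite box.\<close>

lemma finite_mons: "finite (mons d m)"
proof (rule inj_on_finite)
  let ?r = "\<lambda>\<mu> :: monom. restrict (Poly_Mapping.lookup \<mu>) (index_set d)"
  show "inj_on ?r (mons d m)"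
    using bij_betw_imp_inj_on[OF bij_betw_monom_PiE[OF finite_index_set]]
    by (rule inj_on_subset) (auto simp: mons_def)
  have "Poly_Mapping.lookup \<mu> v \<le> monom_degree \<mu>" for \<mu> v
    unfolding monom_degree_def
    by (cases "v \<in> Poly_Mapping.keys \<mu>") (auto intro: member_le_sum simp: not_in_keys_iff_lookup_eq_zero)
  then show "?r ` mons d m \<subseteq> index_set d \<rightarrow>\<^sub>E {..m}"
    by (auto simp: mons_def)
  show "finite (index_set d \<rightarrow>\<^sub>E {..m})"
    by (rule finite_PiE) (auto simp: finite_index_set)
qed


text \<open>Provides the weight bound of the locale: each variable has weight of absolute value at
  most \<open>d ! k\<close>, hence at most \<open>sum_list d\<close>, and a monomial of degree
  \<open>m\<close> has \<open>m\<close> factors.\<close>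

lemma abs_weight_le: "\<mu> \<in> mons d m \<Longrightarrow> \<bar>weight d \<mu>\<bar> \<le> int (sum_list d * m)"
proof -
  assume \<mu>: "\<mu> \<in> mons d m"
  have "\<bar>weight d \<mu>\<bar> \<le> (\<Sum>v\<in>Poly_Mapping.keys \<mu>. \<bar>wt d v * int (Poly_Mapping.lookup \<mu> v)\<bar>)"
    unfolding weight_def by (rule sum_abs)
  also have "\<dots> \<le> (\<Sum>v\<in>Poly_Mapping.keys \<mu>. int (sum_list d) * int (Poly_Mapping.lookup \<mu> v))"
  proof (rule sum_mono)
    fix v assume "v \<in> Poly_Mapping.keys \<mu>"
    with \<mu> obtain k i where "v = (k, i)" "k < length d" "i \<le> d ! k"
      by (auto simp: mons_def index_set_def)
    moreover from this have "d ! k \<le> sum_list d" by (simp add: elem_le_sum_list)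
    ultimately have "\<bar>wt d v\<bar> \<le> int (sum_list d)" by (simp add: wt_def)
    then show "\<bar>wt d v * int (Poly_Mapping.lookup \<mu> v)\<bar> \<le> int (sum_list d) * int (Poly_Mapping.lookup \<mu> v)"
      by (simp add: abs_mult mult_right_mono)
  qed
  also have "\<dots> = int (sum_list d * m)"
    using \<mu> by (auto simp: mons_def monom_degree_def sum_distrib_left)
  finally show ?thesis .
qed

section \<open>The forms of degree m as an sl2-module\<close>

lemma linear_derivation:
  "Vector_Spaces.linear mscale mscale (derivation f :: 'a::field mpoly \<Rightarrow> 'a mpoly)"
  unfolding Vector_Spaces.linear_iff
  using mpoly.vector_space_axioms derivation_add derivation_mscale by blast

lemma weight_part_subset_poly_alg: "weight_part d m A \<subseteq> poly_alg d"
  by (auto simp: weight_part_def supported_def mons_def poly_alg_def)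

lemma weight_part_mono: "A \<subseteq> B \<Longrightarrow> weight_part d m A \<subseteq> weight_part d m B"
  by (auto simp: weight_part_def supported_def)

lemma subspace_weight_part: "mpoly.subspace (weight_part d m A :: 'a::field mpoly set)"
  unfolding weight_part_def by (rule subspace_supported)

lemma finite_weight_mons: "finite {\<mu>\<in>mons d m. weight d \<mu> \<in> A}"
  using finite_mons by simp

lemma dim_weight_part:
  "mpoly.dim (weight_part d m A :: 'a::field mpoly set) = card {\<mu>\<in>mons d m. weight d \<mu> \<in> A}"
  unfolding weight_part_def by (rule dim_supported[OF finite_weight_mons])

lemma sl2_weight_part:
  "sl2_weight_module (mscale :: 'a::field_char_0 \<Rightarrow> _) (D_op d) (D_star d)
     (\<lambda>w. weight_part d m {w}) (sum_list d * m)"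
proof (intro sl2_weight_module.intro sl2_weight_module_axioms.intro mpoly.vector_space_axioms)
  fix w and p :: "'a mpoly"
  show "Vector_Spaces.linear mscale mscale (D_op d :: 'a mpoly \<Rightarrow> _)"
    "Vector_Spaces.linear mscale mscale (D_star d :: 'a mpoly \<Rightarrow> _)"
    unfolding D_op_def D_star_def by (rule linear_derivation)+
  show "mpoly.subspace (weight_part d m {w} :: 'a mpoly set)" by (rule subspace_weight_part)
  assume p: "p \<in> weight_part d m {w}"
  have "{v. v - 2 \<in> {w}} = {w + 2}" "{v. v + 2 \<in> {w}} = {w - 2}" by auto
  then show "D_op d p \<in> weight_part d m {w + 2}" "D_star d p \<in> weight_part d m {w - 2}"
    using D_op_weight_part[OF p] D_star_weight_part[OF p] by simp_all
  show "D_op d (D_star d p) = D_star d (D_op d p) + mscale (of_int w) p"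
  proof -
    have "Poly_Mapping.lookup (D_op d (D_star d p) - D_star d (D_op d p)) \<mu> =
        Poly_Mapping.lookup (mscale (of_int w) p) \<mu>" for \<mu>
    proof (cases "\<mu> \<in> Poly_Mapping.keys p")
      case True
      then have "weight d \<mu> = w" using p by (auto simp: weight_part_def supported_def)
      moreover have "p \<in> poly_alg d" using p weight_part_subset_poly_alg by blast
      ultimately show ?thesis by (simp only: lookup_D_commutator lookup_mscale)
    next
      case False
      moreover have "p \<in> poly_alg d" using p weight_part_subset_poly_alg by blast
      ultimately show ?thesis
        by (simp only: lookup_D_commutator lookup_mscale not_in_keys_iff_lookup_eq_zero mult_zero_right)
    qed
    then have "D_op d (D_star d p) - D_star d (D_op d p) = mscale (of_int w) p"
      by (rule poly_mapping_eqI)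
    then show ?thesis by (simp add: algebra_simps)
  qed
  assume "int (sum_list d * m) < \<bar>w\<bar>"
  then have empty: "{\<mu>\<in>mons d m. weight d \<mu> \<in> {w}} = {}"
    using abs_weight_le by fastforce
  have "Poly_Mapping.keys p \<subseteq> {}"
    using p unfolding weight_part_def supported_def empty by (rule CollectD)
  then show "p = 0" by simp
qed

text \<open>Weights of at least -1 are raised to weights of at least 1, where \<open>E_surj\<close>
  gives a preimage of each term of \<open>p\<close> separately; the image is a subspace and so
  contains their sum.\<close>

lemma D_op_image_weight_part:
  assumes "\<And>w. w \<in> A \<Longrightarrow> - 1 \<le> w"
  shows "D_op d ` weight_part d m A = (weight_part d m {w. w - 2 \<in> A} :: 'a::field_char_0 mpoly set)"
proof
  interpret sl2_weight_module "mscale :: 'a \<Rightarrow> _" "D_op d" "D_star d"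
    "\<lambda>w. weight_part d m {w}" "sum_list d * m"
    by (rule sl2_weight_part)
  show "D_op d ` weight_part d m A \<subseteq> (weight_part d m {w. w - 2 \<in> A} :: 'a mpoly set)"
    using D_op_weight_part by blast
  show "(weight_part d m {w. w - 2 \<in> A} :: 'a mpoly set) \<subseteq> D_op d ` weight_part d m A"
  proof
    fix p :: "'a mpoly" assume p: "p \<in> weight_part d m {w. w - 2 \<in> A}"
    have "Poly_Mapping.single \<mu> (Poly_Mapping.lookup p \<mu>) \<in> D_op d ` weight_part d m A"
      if "\<mu> \<in> Poly_Mapping.keys p" for \<mu>
    proof -
      have \<mu>: "\<mu> \<in> mons d m" "weight d \<mu> - 2 \<in> A"
        using p that by (auto simp: weight_part_def supported_def)
      then have "Poly_Mapping.single \<mu> (Poly_Mapping.lookup p \<mu>)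
          \<in> D_op d ` weight_part d m {weight d \<mu> - 2}"
        using assms[OF \<mu>(2)] by (intro E_surj) (auto simp: weight_part_def supported_def)
      also have "\<dots> \<subseteq> D_op d ` weight_part d m A"
        using \<mu>(2) by (intro image_mono weight_part_mono) simp
      finally show ?thesis .
    qed
    moreover have "mpoly.subspace (D_op d ` weight_part d m A :: 'a mpoly set)"
      by (rule E.subspace_image[OF subspace_weight_part])
    ultimately show "p \<in> D_op d ` weight_part d m A"
      by (subst mpoly_eq_sum_single) (rule mpoly.subspace_sum)
  qed
qed

text \<open>If a negative weight \<open>w\<close> occurred in \<open>p\<close>, split off the
  component \<open>q\<close> of that weight. The images of \<open>q\<close> and of the rest
  \<open>r\<close> have different weights and cannot cancel, so \<open>D_op\<close> kills
  \<open>q\<close>, and \<open>E_inj\<close> gives \<open>q = 0\<close>, a contradiction.\<close>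

lemma D_op_kernel_weight_nonneg:
  fixes p :: "'a::field_char_0 mpoly"
  assumes p: "p \<in> weight_part d m UNIV" and D: "D_op d p = 0"
  shows "p \<in> weight_part d m {0..}"
proof -
  interpret sl2_weight_module "mscale :: 'a \<Rightarrow> _" "D_op d" "D_star d"
    "\<lambda>w. weight_part d m {w}" "sum_list d * m"
    by (rule sl2_weight_part)
  have "0 \<le> weight d \<mu>" if "\<mu> \<in> Poly_Mapping.keys p" for \<mu>
  proof (rule ccontr)
    define w where "w = weight d \<mu>"
    assume "\<not> 0 \<le> weight d \<mu>"
    then have w: "w < 0" by (simp add: w_def)
    let ?t = "\<lambda>\<nu>. Poly_Mapping.single \<nu> (Poly_Mapping.lookup p \<nu>)"
    define q where "q = (\<Sum>\<nu>\<in>{\<nu>\<in>Poly_Mapping.keys p. weight d \<nu> = w}. ?t \<nu>)"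
    define r where "r = (\<Sum>\<nu>\<in>{\<nu>\<in>Poly_Mapping.keys p. weight d \<nu> \<noteq> w}. ?t \<nu>)"
    have q: "q \<in> weight_part d m {w}"
      unfolding q_def by (rule mpoly.subspace_sum[OF subspace_weight_part])
        (use p in \<open>auto simp: weight_part_def supported_def\<close>)
    have r: "r \<in> weight_part d m (- {w})"
      unfolding r_def by (rule mpoly.subspace_sum[OF subspace_weight_part])
        (use p in \<open>auto simp: weight_part_def supported_def\<close>)
    have "p = (\<Sum>\<nu>\<in>Poly_Mapping.keys p. ?t \<nu>)" by (rule mpoly_eq_sum_single)
    also have "\<dots> = q + r"
      unfolding q_def r_def by (subst sum.union_disjoint[symmetric]) (auto intro: sum.cong)
    finally have pqr: "p = q + r" .
    then have "D_op d q = - D_op d r" using D by (simp add: E.add eq_neg_iff_add_eq_0)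
    \<comment> \<open>Negation preserves the support; two supports that are both equal and disjoint
      are empty.\<close>
    then have "Poly_Mapping.keys (D_op d q) = Poly_Mapping.keys (D_op d r)" by simp
    moreover have "Poly_Mapping.keys (D_op d q) \<inter> Poly_Mapping.keys (D_op d r) = {}"
      using D_op_weight_part[OF q] D_op_weight_part[OF r]
      by (auto simp: weight_part_def supported_def simp del: keys_eq_empty)
    ultimately have "D_op d q = 0" by simp
    then have "q = 0" using E_inj[OF q w] by simp
    then show False using pqr r that by (auto simp: weight_part_def supported_def w_def)
  qed
  then show ?thesis using p by (auto simp: weight_part_def supported_def)
qed

section \<open>Dimensions of kernels, invariants and semi-invariants\<close>

text \<open>Rank-nullity for \<open>D_op\<close> on \<open>weight_part d m A\<close>: the last
  summand is the rank, because the image is the whole part with weights in \<open>A\<close> shifted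
  by 2. The additive form avoids truncated subtraction.\<close>

lemma dim_D_op_kernel:
  assumes "\<And>w. w \<in> A \<Longrightarrow> - 1 \<le> w"
  shows "card {\<mu>\<in>mons d m. weight d \<mu> \<in> A} =
    mpoly.dim {p \<in> weight_part d m A. D_op d p = (0 :: 'a::field_char_0 mpoly)}
    + card {\<mu>\<in>mons d m. weight d \<mu> - 2 \<in> A}"
proof -
  have "mpoly.dim (weight_part d m A :: 'a mpoly set) =
      mpoly.dim {p \<in> weight_part d m A. D_op d p = (0 :: 'a mpoly)} + mpoly.dim (D_op d ` weight_part d m A :: 'a mpoly set)"
  proof (rule mpoly.dim_kernel_image[OF _ subspace_weight_part])
    show "Vector_Spaces.linear mscale mscale (D_op d :: 'a mpoly \<Rightarrow> _)"
      unfolding D_op_def by (rule linear_derivation)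
    show "(weight_part d m A :: 'a mpoly set) \<subseteq>
        mpoly.span ((\<lambda>\<mu>. Poly_Mapping.single \<mu> 1) ` {\<mu>\<in>mons d m. weight d \<mu> \<in> A})"
      unfolding weight_part_def by (rule supported_subset_span)
  qed (simp add: finite_mons)
  then show ?thesis
    by (simp add: D_op_image_weight_part[OF assms] dim_weight_part)
qed

lemma hom_component_poly_alg:
  "hom_component {p \<in> poly_alg d. P p} m = {p \<in> weight_part d m UNIV. P p}"
  unfolding hom_component_def weight_part_def supported_def mons_def poly_alg_def by blast

text \<open>If both operators kill \<open>p\<close>, so does their commutator, which multiplies the
  coefficient of \<open>\<mu>\<close> by \<open>weight d \<mu>\<close>; in characteristic 0 only
  weight 0 remains. The converse inclusion is \<open>F_eq_0\<close>.\<close>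

lemma hom_component_invariants:
  "hom_component (joint_invariants d) m =
    {p \<in> weight_part d m {0}. D_op d p = (0 :: 'a::field_char_0 mpoly)}"
proof -
  interpret sl2_weight_module "mscale :: 'a \<Rightarrow> _" "D_op d" "D_star d"
    "\<lambda>w. weight_part d m {w}" "sum_list d * m"
    by (rule sl2_weight_part)
  have "p \<in> weight_part d m {0}"
    if p: "p \<in> weight_part d m UNIV" and D: "D_op d p = 0" "D_star d p = 0" for p :: "'a mpoly"
  proof -
    have "p \<in> poly_alg d" using p weight_part_subset_poly_alg by blast
    then have "weight d \<mu> = 0" if "\<mu> \<in> Poly_Mapping.keys p" for \<mu>
      using that lookup_D_commutator[of p d \<mu>] unfolding D E.zero F.zero by (simp add: in_keys_iff)
    then show ?thesis using p by (auto simp: weight_part_def supported_def)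
  qed
  then show ?thesis
    unfolding joint_invariants_def hom_component_poly_alg
    using F_eq_0 weight_part_mono[of "{0}" UNIV] by blast
qed

lemma hom_component_semi_invariants:
  "hom_component (joint_semi_invariants d) m =
    {p \<in> weight_part d m {0..}. D_op d p = (0 :: 'a::field_char_0 mpoly)}"
  unfolding joint_semi_invariants_def hom_component_poly_alg
  using D_op_kernel_weight_nonneg weight_part_mono[of "{0..}" UNIV] by blast

theorem theorem2p1:
  fixes d :: "nat list" and m :: nat
  assumes "d \<noteq> []"
  shows "int (mpoly.dim (hom_component (joint_invariants d :: 'a::field_char_0 mpoly set) m))
           = int (omega m d 0) - int (omega m d 2) \<and>
         mpoly.dim (hom_component (joint_semi_invariants d :: 'a::field_char_0 mpoly set) m)
           = omega m d 0 + omega m d 1"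
proof
  \<comment> \<open>With \<open>A = {0}\<close> the rank counts the monomials of weight 2.\<close>
  show "int (mpoly.dim (hom_component (joint_invariants d :: 'a mpoly set) m))
      = int (omega m d 0) - int (omega m d 2)"
    using dim_D_op_kernel[where ?'a = 'a, of "{0}" d m]
    by (simp add: hom_component_invariants card_mons_weight)
  \<comment> \<open>With \<open>A = {0..}\<close> the rank counts the weights from 2 on; splitting
    off the weights 0 and 1 makes this count cancel.\<close>
  have "{\<mu>\<in>mons d m. weight d \<mu> \<in> {0..}} = {\<mu>\<in>mons d m. weight d \<mu> = 0} \<union>
      ({\<mu>\<in>mons d m. weight d \<mu> = 1} \<union> {\<mu>\<in>mons d m. weight d \<mu> - 2 \<in> {0..}})"
    by auto
  then have "card {\<mu>\<in>mons d m. weight d \<mu> \<in> {0..}} =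
      omega m d 0 + (omega m d 1 + card {\<mu>\<in>mons d m. weight d \<mu> - 2 \<in> {0..}})"
    by (simp only: card_mons_weight[symmetric], subst card_Un_disjoint)
      (simp_all add: finite_mons, auto simp: finite_mons intro!: card_Un_disjoint)
  then show "mpoly.dim (hom_component (joint_semi_invariants d :: 'a mpoly set) m)
      = omega m d 0 + omega m d 1"
    using dim_D_op_kernel[where ?'a = 'a, of "{0..}" d m]
    by (simp add: hom_component_semi_invariants)
qed

end
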